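(* Let $f:\mathbb{R}^d\to\mathbb{R}$ be differentiable and convex and admit a minimizer; let $x^\star$ be a minimizer and $f^\star:=f(x^\star)$. Suppose $f$ is matrix smooth with matrix $\mathbb{L}$, $L:=\|\mathbb{L}\|$, and the sketch moment conditions hold with constants $\omega,\ell>0$ (as in the context). Let $\{x_k,z_k,A_k\}_{k\ge0}$ be generated by algorithm RS-NAG-C (as in the context), and let $$\Phi_k^{\mathrm C}:=A_k\big(f(x_k)-f^\star\big)+\tfrac12\|z_k-x^\star\|^2.$$ Then $(\Phi_k^{\mathrm C})_{k\ge0}$ is a nonnegative supermartingale: $\mathbb{E}[\Phi_{k+1}^{\mathrm C}\mid\mathcal F_k]\le\Phi_k^{\mathrm C}$ for all $k\ge0$, where $\mathcal F_k:=\sigma(P_0,\dots,P_{k-1})$. Consequently: (i) For every $\eta\in(0,1)$, with probability at least $1-\eta$, $$A_k\big(f(x_k)-f^\star\big)\le\frac{\Phi_0^{\mathrm C}}{\eta}\quad\text{for all }k\ge0,$$ and consequently, since $A_k>0$ for all $k\ge1$, $f(x_k)-f^\star\le\dfrac{\Phi_0^{\mathrm C}}{\eta A_k}$ for all $k\ge1$. (ii) Fix any $\varepsilon>0$. Then, almost surely, there exists a finite random integer $K_\varepsilon$ such that for all integers $k\ge K_\varepsilon$, $$A_k\big(f(x_k)-f^\star\big)\le\Phi_0^{\mathrm C}\,\lceil\log_2k\rceil\big(\log\lceil\log_2k\rceil\big)^{1+\varepsilon},$$ and consequently, for all $k\ge K_\varepsilon$, $$f(x_k)-f^\star\le\frac{\Phi_0^{\mathrm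 C}\,\lceil\log_2k\rceil\big(\log\lceil\log_2k\rceil\big)^{1+\varepsilon}}{A_k}.$$ Moreover, $A_k\ge\dfrac{m}{2\omega}k^2=\dfrac{k^2}{4L\ell\omega}$ for all $k\ge0$, where $m=1/(2L\ell)$, and therefore, for all $k\ge K_\varepsilon$, $$f(x_k)-f^\star\le4L\ell\omega\,\Phi_0^{\mathrm C}\,\frac{\lceil\log_2k\rceil\big(\log\lceil\log_2k\rceil\big)^{1+\varepsilon}}{k^2}.$$
   Context: Standing assumptions: $d\ge2$, $1\le r\le d$. $\|\cdot\|$ is the Euclidean norm for vectors and the induced operator norm for matrices; $A\preceq B$ means $B-A$ is positive semidefinite. Matrix smoothness: there is a fixed symmetric matrix $\mathbb{L}\in\mathbb{R}^{d\times d}$, $\mathbb{L}\succeq0$, $\mathbb{L}\ne0$, such that for all $x,y\in\mathbb{R}^d$, $f(y)\le f(x)+\langle\nabla f(x),y-x\rangle+\tfrac12(y-x)^\top\mathbb{L}(y-x)$. Put $L:=\|\mathbb{L}\|$. Sketch moment conditions: $P\in\mathbb{R}^{d\times r}$ is a random matrix (the expectations below being finite) and $\omega>0,\ell>0$ are constants with $\mathbb{E}[PP^\top]=I_d$, $\mathbb{E}[(PP^\top)^2]\preceq\omega I_d$, $\mathbb{E}[PP^\top\mathbb{L}PP^\top]\preceq\ell L\,I_d$. Algorithm RS-NAG-C: given deterministic $x_0\in\mathbb{R}^d$ and i.i.d. copies $P_k$ of $P$, set $m=1/(2L\ell)$, $A_0=0$, $z_0=x_0$, and for $k=0,1,2,\dots$: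 $a_{k+1}=\dfrac{m+\sqrt{m^2+2\omega mA_k}}{\omega}$, $A_{k+1}=A_k+a_{k+1}$, $y_k=\dfrac{A_k}{A_{k+1}}x_k+\dfrac{a_{k+1}}{A_{k+1}}z_k$, $x_{k+1}=y_k-\dfrac1{L\ell}P_kP_k^\top\nabla f(y_k)$, $z_{k+1}=z_k-a_{k+1}P_kP_k^\top\nabla f(y_k)$. *)

theory Defs
  imports "HOL-Probability.Probability"
begin

definition psd :: "real ^ 'n ^ 'n \<Rightarrow> bool" where
  "psd A \<longleftrightarrow> transpose A = A \<and> (\<forall>v. 0 \<le> v \<bullet> (A *v v))"

definition loewner_le :: "real ^ 'n ^ 'n \<Rightarrow> real ^ 'n ^ 'n \<Rightarrow> bool"  (infix "\<preceq>" 50) where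
  "A \<preceq> B \<longleftrightarrow> psd (B - A)"

text \<open>Meaningful only at points of differentiability; there it is the unique Riesz representer of
  the derivative, as the lemma below shows.\<close>

definition gradient :: "(real ^ 'n \<Rightarrow> real) \<Rightarrow> real ^ 'n \<Rightarrow> real ^ 'n" where
  "gradient f x = (THE g. GDERIV f x :> g)"

lemma GDERIV_gradient:
  assumes "f differentiable (at x)"
  shows "GDERIV f x :> gradient f x"
proof -
  obtain D where D: "(f has_derivative D) (at x)"
    using assms by (auto simp: differentiable_def)
  have lin: "linear D"
    using D by (rule has_derivative_linear)
  have ex: "GDERIV f x :> adjoint D 1"
    unfolding gderiv_def using D by (simp add: adjoint_works[OF lin] inner_real_def)
  have unique: "g = g'" if "GDERIV f x :> g" "GDERIV f x :> g'" for g g'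
  proof -
    have "(\<lambda>h. h \<bullet> g) = (\<lambda>h. h \<bullet> g')"
      using that unfolding gderiv_def by (rule has_derivative_unique)
    then have "\<forall>h. h \<bullet> g = h \<bullet> g'"
      unfolding fun_eq_iff .
    then show ?thesis
      by (simp only: vector_eq_ldot)
  qed
  show ?thesis
    unfolding gradient_def using ex unique[OF _ ex] by (rule theI)
qed

definition matrix_smooth :: "(real ^ 'n \<Rightarrow> real) \<Rightarrow> real ^ 'n ^ 'n \<Rightarrow> bool" where
  "matrix_smooth f LL \<longleftrightarrow>
     (\<forall>x y. f y \<le> f x + gradient f x \<bullet> (y - x) + 1/2 * ((y - x) \<bullet> (LL *v (y - x))))"

definition sketch :: "real ^ 'r ^ 'd \<Rightarrow> real ^ 'd ^ 'd" where
  "sketch P = P ** transpose P"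

text \<open>\<open>N\<close> carries a generic copy \<open>P\<close> of the sketch matrix. Expectations are Bochner integrals of
  matrix-valued functions, i.e. entrywise; integrability is stated explicitly because the integral
  of a non-integrable function is 0 by convention.\<close>

definition sketch_moments ::
  "'b measure \<Rightarrow> ('b \<Rightarrow> real ^ 'r ^ 'd) \<Rightarrow> real ^ 'd ^ 'd \<Rightarrow> real \<Rightarrow> real \<Rightarrow> bool" where
  "sketch_moments N P LL \<omega> ell \<longleftrightarrow>
     P \<in> borel_measurable N \<and>
     integrable N (\<lambda>s. sketch (P s)) \<and>
     integrable N (\<lambda>s. sketch (P s) ** sketch (P s)) \<and>
     integrable N (\<lambda>s. sketch (P s) ** LL ** sketch (P s)) \<and>
     (\<integral>s. sketch (P s) \<partial>N) = mat 1 \<and>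
     (\<integral>s. sketch (P s) ** sketch (P s) \<partial>N) \<preceq> \<omega> *\<^sub>R mat 1 \<and>
     (\<integral>s. sketch (P s) ** LL ** sketch (P s) \<partial>N) \<preceq> (ell * onorm ((*v) LL)) *\<^sub>R mat 1"

text \<open>\<open>nag_incr m \<omega> A\<close> is $a_{k+1}$ as a function of $A = A_k$.\<close>

definition nag_incr :: "real \<Rightarrow> real \<Rightarrow> real \<Rightarrow> real" where
  "nag_incr m \<omega> A = (m + sqrt (m\<^sup>2 + 2 * \<omega> * m * A)) / \<omega>"

primrec nag_A :: "real \<Rightarrow> real \<Rightarrow> nat \<Rightarrow> real" where
  "nag_A m \<omega> 0 = 0"
| "nag_A m \<omega> (Suc k) = nag_A m \<omega> k + nag_incr m \<omega> (nag_A m \<omega> k)"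

text \<open>The pair $(x_k, z_k)$ produced from the realised sketches \<open>S 0, S 1, \<dots>\<close>. The scalar
  argument \<open>L\<close> is the smoothness constant.\<close>

primrec rs_nag_c ::
  "(real ^ 'd \<Rightarrow> real) \<Rightarrow> real \<Rightarrow> real \<Rightarrow> real \<Rightarrow> real ^ 'd \<Rightarrow> (nat \<Rightarrow> real ^ 'r ^ 'd) \<Rightarrow> nat
     \<Rightarrow> (real ^ 'd) \<times> (real ^ 'd)" where
  "rs_nag_c f L \<omega> ell x0 S 0 = (x0, x0)"
| "rs_nag_c f L \<omega> ell x0 S (Suc k) =
     (let (x, z) = rs_nag_c f L \<omega> ell x0 S k;
          m = 1 / (2 * L * ell);
          A = nag_A m \<omega> k;
          a = nag_incr m \<omega> A;
          A' = nag_A m \<omega> (Suc k);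
          y = (A / A') *\<^sub>R x + (a / A') *\<^sub>R z;
          g = sketch (S k) *v gradient f y
      in (y - (1 / (L * ell)) *\<^sub>R g, z - a *\<^sub>R g))"

definition past :: "'a measure \<Rightarrow> (nat \<Rightarrow> 'a \<Rightarrow> 'v::topological_space) \<Rightarrow> nat \<Rightarrow> 'a measure" where
  "past M X k = sigma (space M) (\<Union>i<k. {X i -` B \<inter> space M | B. B \<in> sets borel})"

definition supermartingale ::
  "'a measure \<Rightarrow> (nat \<Rightarrow> 'a measure) \<Rightarrow> (nat \<Rightarrow> 'a \<Rightarrow> real) \<Rightarrow> bool" where
  "supermartingale M F X \<longleftrightarrow>
     (\<forall>k. subalgebra M (F k)) \<and> (\<forall>k. sets (F k) \<subseteq> sets (F (Suc k))) \<and>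
     (\<forall>k. X k \<in> borel_measurable (F k)) \<and> (\<forall>k. integrable M (X k)) \<and>
     (\<forall>k. AE s in M. real_cond_exp M (F k) (X (Suc k)) s \<le> X k s)"

end

theory Submission
  imports Defs "HOL-Real_Asymp.Real_Asymp"
begin

text \<open>For fixed $x_k, z_k$, matrix smoothness bounds $\Phi_{k+1}$ by an expression linear in $G$, $G^2$ and
  $G \mathbb{L} G$ for $G = P_k P_k^\top$. The choice of $a_{k+1}$ means
  $\frac{1}{2} \omega a_{k+1}^2 = m A_{k+1}$, so after taking expectations the terms in
  $\|\nabla f(y_k)\|^2$ cancel, and convexity of $f$ at $y_k$ bounds the rest by $\Phi_k$. Since $P_k$
  is independent of the past, this is the supermartingale property. Ville's maximal inequality gives (i),
  and also shows that almost surely $\Phi_k$ is bounded by a finite random multiple of $\Phi_0$. The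
  factor in (ii) tends to infinity and eventually exceeds that multiple, so no Borel-Cantelli argument
  over dyadic blocks is needed.\<close>

section \<open>Step sizes and their growth\<close>

lemma nag_incr_pos:
  assumes "0 < m" "0 < \<omega>" "0 \<le> A"
  shows "0 < nag_incr m \<omega> A"
  unfolding nag_incr_def using assms by (intro divide_pos_pos add_pos_nonneg) auto

text \<open>By the quadratic formula the increment is the larger root of this equation. The identity
  balances the second-order terms in \<open>sketch_step_bound\<close>.\<close>

lemma nag_incr_quadratic:
  assumes "0 < m" "0 < \<omega>" "0 \<le> A"
  shows "\<omega> * (nag_incr m \<omega> A)\<^sup>2 / 2 = m * (A + nag_incr m \<omega> A)"
proof -
  define q where "q = sqrt (m\<^sup>2 + 2 * \<omega> * m * A)"
  have q: "q\<^sup>2 = m\<^sup>2 + 2 * \<omega> * m * A"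
    unfolding q_def using assms by simp
  have a: "nag_incr m \<omega> A = (m + q) / \<omega>"
    by (simp add: nag_incr_def q_def)
  have "\<omega> * ((m + q) / \<omega>)\<^sup>2 / 2 = (m\<^sup>2 + 2 * m * q + q\<^sup>2) / (2 * \<omega>)"
    using assms by (simp add: field_simps power2_eq_square)
  also have "\<dots> = m * (A + (m + q) / \<omega>)"
    unfolding q using assms by (simp add: field_simps power2_eq_square)
  finally show ?thesis
    by (simp add: a)
qed

lemma nag_A_nonneg:
  assumes "0 < m" "0 < \<omega>"
  shows "0 \<le> nag_A m \<omega> k"
  by (induction k) (auto intro!: add_nonneg_nonneg less_imp_le[OF nag_incr_pos] assms)

text \<open>Inserting the bound for \<open>k\<close> under the square root shows that the root is at
  least \<open>m * k\<close>, so the increment is at least \<open>m * (k + 1) / \<omega>\<close>.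
  The induction step needs only \<open>m * (2 * k + 1) / (2 * \<omega>)\<close>.\<close>

lemma nag_A_growth:
  assumes "0 < m" "0 < \<omega>"
  shows "m / (2 * \<omega>) * (real k)\<^sup>2 \<le> nag_A m \<omega> k"
proof (induction k)
  case (Suc k)
  define A where "A = nag_A m \<omega> k"
  have "m * real k = sqrt ((m * real k)\<^sup>2)"
    using assms by simp
  also have "(m * real k)\<^sup>2 = 2 * \<omega> * m * (m / (2 * \<omega>) * (real k)\<^sup>2)"
    using assms by (simp add: field_simps power2_eq_square)
  also have "sqrt \<dots> \<le> sqrt (m\<^sup>2 + 2 * \<omega> * m * A)"
  proof (rule real_sqrt_le_mono)
    have "2 * \<omega> * m * (m / (2 * \<omega>) * (real k)\<^sup>2) \<le> 2 * \<omega> * m * A"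
      using Suc assms by (intro mult_left_mono) (auto simp: A_def)
    then show "2 * \<omega> * m * (m / (2 * \<omega>) * (real k)\<^sup>2) \<le> m\<^sup>2 + 2 * \<omega> * m * A"
      by (smt (verit) zero_le_power2)
  qed
  finally have "(m + m * real k) / \<omega> \<le> nag_incr m \<omega> A"
    unfolding nag_incr_def using assms by (intro divide_right_mono) auto
  moreover have "m / (2 * \<omega>) * (real (Suc k))\<^sup>2 \<le> m / (2 * \<omega>) * (real k)\<^sup>2 + (m + m * real k) / \<omega>"
    using assms by (simp add: field_simps power2_eq_square)
  ultimately show ?case
    using Suc by (simp add: A_def)
qed simp

section \<open>First-order convexity and measurability of the gradient\<close>

text \<open>Along the path \<open>y + t *\<^sub>R (u - y)\<close> this is the tangent inequality at
  \<open>0\<close> for a convex function of one real variable, evaluated at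
  \<open>1\<close>.\<close>

lemma convex_on_above_gradient:
  fixes f :: "real ^ 'd \<Rightarrow> real"
  assumes "convex_on UNIV f" "f differentiable (at y)"
  shows "f y + gradient f y \<bullet> (u - y) \<le> f u"
proof -
  define \<phi> where "\<phi> = (\<lambda>t. f (y + t *\<^sub>R (u - y)))"
  have "convex_on UNIV \<phi>"
  proof (rule convex_onI)
    fix t a b :: real
    assume t: "0 < t" "t < 1"
    have "y + ((1 - t) *\<^sub>R a + t *\<^sub>R b) *\<^sub>R (u - y)
        = (1 - t) *\<^sub>R (y + a *\<^sub>R (u - y)) + t *\<^sub>R (y + b *\<^sub>R (u - y))"
      by (simp add: algebra_simps)
    then show "\<phi> ((1 - t) *\<^sub>R a + t *\<^sub>R b) \<le> (1 - t) * \<phi> a + t * \<phi> b"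
      unfolding \<phi>_def using convex_onD[OF assms(1), of t] t by simp
  qed simp
  moreover have "(\<phi> has_real_derivative gradient f y \<bullet> (u - y)) (at 0)"
  proof -
    \<comment> \<open>The base point \<open>y\<close> is written as the value of the path at
      \<open>0\<close>, so that the chain rule applies to it.\<close>
    have "(f has_derivative (\<lambda>h. h \<bullet> gradient f y)) (at (y + 0 *\<^sub>R (u - y)))"
      using GDERIV_gradient[OF assms(2)] by (simp add: gderiv_def)
    moreover have "((\<lambda>t. y + t *\<^sub>R (u - y)) has_derivative (\<lambda>t. t *\<^sub>R (u - y))) (at 0)"
      by (auto intro!: derivative_eq_intros)
    ultimately have "(\<phi> has_derivative (\<lambda>t. (t *\<^sub>R (u - y)) \<bullet> gradient f y)) (at 0)"
      unfolding \<phi>_def by (rule has_derivative_compose[rotated])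
    then show ?thesis
      by (simp add: has_field_derivative_def inner_commute mult_commute_abs)
  qed
  ultimately have "\<phi> 1 - \<phi> 0 \<ge> (gradient f y \<bullet> (u - y)) * (1 - 0)"
    by (intro convex_on_imp_above_tangent[of UNIV]) auto
  then show ?thesis
    by (simp add: \<phi>_def)
qed

lemma borel_measurable_vecI:
  fixes g :: "'a \<Rightarrow> real ^ 'd"
  assumes "\<And>i. (\<lambda>x. g x $ i) \<in> borel_measurable M"
  shows "g \<in> borel_measurable M"
  using assms by (subst borel_measurable_euclidean_space) (auto simp: Basis_vec_def inner_axis)

text \<open>Each partial derivative is a pointwise limit of difference quotients of the continuous
  function \<open>f\<close>, hence Borel even where the gradient is not known to be
  continuous.\<close>

lemma borel_measurable_gradient:
  fixes f :: "real ^ 'd \<Rightarrow> real"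
  assumes "\<And>u. f differentiable (at u)"
  shows "gradient f \<in> borel_measurable borel"
proof (rule borel_measurable_vecI)
  fix i
  have "continuous_on UNIV f"
    using assms by (meson continuous_at_imp_continuous_on differentiable_imp_continuous_within)
  then have [measurable]: "f \<in> borel_measurable borel"
    by (rule borel_measurable_continuous_onI)
  have "(\<lambda>n. (f (u + inverse (real (Suc n)) *\<^sub>R axis i 1) - f u) / inverse (real (Suc n)))
      \<longlonglongrightarrow> gradient f u $ i" for u
  proof -
    have "(f has_derivative (\<lambda>h. h \<bullet> gradient f u)) (at (u + 0 *\<^sub>R axis i 1))"
      using GDERIV_gradient[OF assms] by (simp add: gderiv_def)
    moreover have "((\<lambda>t. u + t *\<^sub>R axis i 1) has_derivative (\<lambda>t. t *\<^sub>R axis i 1)) (at 0)"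
      by (auto intro!: derivative_eq_intros)
    ultimately have "((\<lambda>t. f (u + t *\<^sub>R axis i 1)) has_derivative
        (\<lambda>t. (t *\<^sub>R axis i 1) \<bullet> gradient f u)) (at 0)"
      by (rule has_derivative_compose[rotated])
    then have "((\<lambda>t. f (u + t *\<^sub>R axis i 1)) has_field_derivative gradient f u $ i) (at 0)"
      by (simp add: has_field_derivative_def inner_axis' mult_commute_abs)
    then have "(\<lambda>t. (f (u + t *\<^sub>R axis i 1) - f u) / t) \<midarrow>0\<rightarrow> gradient f u $ i"
      by (simp add: has_field_derivative_iff)
    \<comment> \<open>The increments tend to \<open>0\<close> without ever being \<open>0\<close>,
      as the filter \<open>at 0\<close> requires.\<close>
    moreover have "filterlim (\<lambda>n. inverse (real (Suc n))) (at 0) sequentially"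
      by (intro filterlim_atI LIMSEQ_inverse_real_of_nat) auto
    ultimately show ?thesis
      by (rule filterlim_compose)
  qed
  then show "(\<lambda>u. gradient f u $ i) \<in> borel_measurable borel"
    by (rule borel_measurable_LIMSEQ_real) measurable
qed

section \<open>Sketch matrices and the expected one-step decrease\<close>

lemma transpose_sketch: "transpose (sketch P) = sketch P"
  by (simp add: sketch_def matrix_transpose_mul)

lemma sketch_inner: "(sketch P *v u) \<bullet> v = u \<bullet> (sketch P *v v)"
  by (metis dot_lmul_matrix transpose_sketch vector_transpose_matrix)

text \<open>Every coordinate is a polynomial in the entries of \<open>P\<close> and
  \<open>v\<close>. Joint continuity is needed because both the sketch and the gradient it acts on
  are random.\<close>

lemma continuous_on_sketch_mult:
  "continuous_on UNIV (\<lambda>(P :: real ^ 'r ^ 'd, v). sketch P *v v)"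
  unfolding sketch_def matrix_matrix_mult_def matrix_vector_mult_def transpose_def split_beta
  by (intro continuous_on_vec_lambda continuous_intros)

lemma borel_measurable_sketch_mult [measurable]:
  fixes P :: "'a \<Rightarrow> real ^ 'r ^ 'd"
  assumes [measurable]: "P \<in> borel_measurable M" "v \<in> borel_measurable M"
  shows "(\<lambda>s. sketch (P s) *v v s) \<in> borel_measurable M"
  using borel_measurable_continuous_Pair[OF assms, of "\<lambda>P v. sketch P *v v"] continuous_on_sketch_mult
  by (simp add: split_beta)

text \<open>For fixed vectors this is a finite linear combination of the entries of
  \<open>B\<close>. It lets the form be exchanged with the integral of a random matrix.\<close>

lemma bounded_linear_quadratic_form:
  "bounded_linear (\<lambda>B :: real ^ 'd ^ 'd. v \<bullet> (B *v w))"
proof -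
  have "bounded_linear (\<lambda>B :: real ^ 'd ^ 'd. \<Sum>i\<in>UNIV. \<Sum>j\<in>UNIV. v $ i * (B $ i $ j * w $ j))"
    by (intro bounded_linear_sum bounded_linear_const_mult bounded_linear_mult_const
        bounded_linear_compose[OF bounded_linear_vec_nth bounded_linear_vec_nth])
  then show ?thesis
    by (simp add: inner_vec_def matrix_vector_mult_def sum_distrib_left)
qed

lemma integral_quadratic_form:
  fixes G :: "'b \<Rightarrow> real ^ 'd ^ 'd"
  assumes "integrable N G"
  shows "integrable N (\<lambda>s. v \<bullet> (G s *v w))"
    and "(\<integral>s. v \<bullet> (G s *v w) \<partial>N) = v \<bullet> ((\<integral>s. G s \<partial>N) *v w)"
  using integrable_bounded_linear[OF bounded_linear_quadratic_form assms]
    integral_bounded_linear[OF bounded_linear_quadratic_form assms] by auto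

lemma loewner_le_scaled_identityD:
  assumes "B \<preceq> c *\<^sub>R mat 1"
  shows "v \<bullet> (B *v v) \<le> c * (v \<bullet> v)"
proof -
  have "0 \<le> v \<bullet> ((c *\<^sub>R mat 1 - B) *v v)"
    using assms by (simp add: loewner_le_def psd_def)
  also have "\<dots> = c * (v \<bullet> v) - v \<bullet> (B *v v)"
    by (simp add: matrix_vector_mult_diff_rdistrib inner_diff_right scaleR_matrix_vector_assoc[symmetric])
  finally show ?thesis
    by simp
qed

text \<open>The state \<open>x\<close>, \<open>z\<close> is frozen here and only the sketch is
  random, so that the moment conditions apply directly. With the nonnegative integral on the left,
  integrability of the next potential can be concluded from this bound instead of being
  assumed.\<close>

lemma sketch_step_bound:
  fixes f :: "real ^ 'd \<Rightarrow> real" and x z xs :: "real ^ 'd" and P :: "'b \<Rightarrow> real ^ 'r ^ 'd"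
  assumes differentiable: "\<And>u. f differentiable (at u)"
    and convex: "convex_on UNIV f"
    and minimizer: "\<And>u. f xs \<le> f u"
    and smooth: "matrix_smooth f LL"
    and L: "L = onorm ((*v) LL)" "0 < L"
    and pos: "0 < \<omega>" "0 < ell" "0 \<le> A"
    and prob_N: "prob_space N"
    and moments: "sketch_moments N P LL \<omega> ell"
  defines "m \<equiv> 1 / (2 * L * ell)"
  defines "a \<equiv> nag_incr m \<omega> A"
  defines "A' \<equiv> A + a"
  defines "y \<equiv> (A / A') *\<^sub>R x + (a / A') *\<^sub>R z"
  defines "G \<equiv> \<lambda>Q :: real ^ 'r ^ 'd. sketch Q *v gradient f y"
  shows "(\<integral>\<^sup>+s. ennreal (A' * (f (y - (1 / (L * ell)) *\<^sub>R G (P s)) - f xs)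
            + 1/2 * (norm (z - a *\<^sub>R G (P s) - xs))\<^sup>2) \<partial>N)
        \<le> ennreal (A * (f x - f xs) + 1/2 * (norm (z - xs))\<^sup>2)"
proof -
  interpret N: prob_space N by fact
  define g where "g = gradient f y"
  define c where "c = 1 / (L * ell)"
  have c: "0 < c" and m: "0 < m" "c = 2 * m"
    using L pos by (auto simp: c_def m_def)
  have a: "0 < a"
    unfolding a_def using nag_incr_pos m pos by blast
  then have A': "0 < A'"
    using pos by (simp add: A'_def)
  have quad: "\<omega> * a\<^sup>2 / 2 = m * A'"
    unfolding A'_def a_def using nag_incr_quadratic m pos by blast
  let ?q1 = "\<lambda>s. sketch (P s)"
  let ?q2 = "\<lambda>s. sketch (P s) ** sketch (P s)"
  let ?q3 = "\<lambda>s. sketch (P s) ** LL ** sketch (P s)"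
  have i1: "integrable N ?q1" and i2: "integrable N ?q2" and i3: "integrable N ?q3"
    and e1: "(\<integral>s. ?q1 s \<partial>N) = mat 1"
    and e2: "(\<integral>s. ?q2 s \<partial>N) \<preceq> \<omega> *\<^sub>R mat 1"
    and e3: "(\<integral>s. ?q3 s \<partial>N) \<preceq> (ell * L) *\<^sub>R mat 1"
    using moments by (auto simp: sketch_moments_def L)
  \<comment> \<open>\<open>U\<close> is the bound given by smoothness and by expanding the square.
    Its random terms are forms in the three matrices whose means are controlled, so its expectation
    can be computed term by term.\<close>
  define U where "U = (\<lambda>s. A' * (f y - f xs) + 1/2 * (norm (z - xs))\<^sup>2
      + ((- A' * c) * (g \<bullet> (?q1 s *v g)) + (A' * c\<^sup>2 / 2) * (g \<bullet> (?q3 s *v g)))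
      + ((- a) * ((z - xs) \<bullet> (?q1 s *v g)) + (a\<^sup>2 / 2) * (g \<bullet> (?q2 s *v g))))"
  have le_U: "A' * (f (y - c *\<^sub>R G (P s)) - f xs) + 1/2 * (norm (z - a *\<^sub>R G (P s) - xs))\<^sup>2 \<le> U s" for s
  proof -
    let ?h = "?q1 s *v g"
    have h: "G (P s) = ?h"
      by (simp add: G_def g_def)
    have sym: "?h \<bullet> w = g \<bullet> (?q1 s *v w)" for w
      by (rule sketch_inner)
    have "f (y - c *\<^sub>R ?h) \<le> f y + g \<bullet> (- c *\<^sub>R ?h) + 1/2 * ((- c *\<^sub>R ?h) \<bullet> (LL *v (- c *\<^sub>R ?h)))"
      using smooth[unfolded matrix_smooth_def, rule_format, of "y - c *\<^sub>R ?h" y] by (simp add: g_def)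
    also have "LL *v (- c *\<^sub>R ?h) = - c *\<^sub>R (LL *v ?h)"
      by (rule matrix_vector_mult_scaleR)
    also have "f y + g \<bullet> (- c *\<^sub>R ?h) + 1/2 * ((- c *\<^sub>R ?h) \<bullet> (- c *\<^sub>R (LL *v ?h)))
        = f y - c * (g \<bullet> ?h) + c\<^sup>2 / 2 * (?h \<bullet> (LL *v ?h))"
      by (simp add: power2_eq_square)
    \<comment> \<open>Symmetry of the sketch moves it from the left argument of the inner product to
      the right one.\<close>
    also have "?h \<bullet> (LL *v ?h) = g \<bullet> (?q3 s *v g)"
      by (simp add: sym matrix_vector_mul_assoc matrix_mul_assoc)
    finally have "A' * f (y - c *\<^sub>R ?h)
        \<le> A' * (f y - c * (g \<bullet> ?h) + c\<^sup>2 / 2 * (g \<bullet> (?q3 s *v g)))"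
      using A' by (intro mult_left_mono) auto
    moreover have "(norm (z - a *\<^sub>R ?h - xs))\<^sup>2
        = (norm (z - xs))\<^sup>2 - 2 * a * ((z - xs) \<bullet> ?h) + a\<^sup>2 * (?h \<bullet> ?h)"
      unfolding power2_norm_eq_inner
      by (simp add: inner_diff_left inner_diff_right inner_commute power2_eq_square algebra_simps)
    moreover have "?h \<bullet> ?h = g \<bullet> (?q2 s *v g)"
      by (simp add: sym matrix_vector_mul_assoc)
    ultimately show ?thesis
      unfolding h U_def by (simp add: algebra_simps)
  qed
  have nonneg: "0 \<le> A' * (f (y - c *\<^sub>R G (P s)) - f xs) + 1/2 * (norm (z - a *\<^sub>R G (P s) - xs))\<^sup>2" for s
    using A' minimizer by (intro add_nonneg_nonneg mult_nonneg_nonneg) auto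
  note ints = integral_quadratic_form[OF i1] integral_quadratic_form[OF i2] integral_quadratic_form[OF i3]
  have U_int: "integrable N U"
    unfolding U_def by (intro Bochner_Integration.integrable_add integrable_mult_right ints N.integrable_const)
  have "(\<integral>s. U s \<partial>N) = A' * (f y - f xs) + 1/2 * (norm (z - xs))\<^sup>2
      + ((- A' * c) * (g \<bullet> g) + (A' * c\<^sup>2 / 2) * (g \<bullet> ((\<integral>s. ?q3 s \<partial>N) *v g)))
      + ((- a) * ((z - xs) \<bullet> g) + (a\<^sup>2 / 2) * (g \<bullet> ((\<integral>s. ?q2 s \<partial>N) *v g)))"
    unfolding U_def
    by (subst Bochner_Integration.integral_add integral_mult_right_zero ints(2) ints(4) ints(6)
        | simp only: e1 N.prob_space lebesgue_integral_const
        | intro Bochner_Integration.integrable_add integrable_mult_right ints N.integrable_const)+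
      (simp add: N.prob_space)
  \<comment> \<open>The linear terms were evaluated exactly by the mean identity. Only the two
    quadratic terms are estimated, and their coefficients are nonnegative.\<close>
  also have "\<dots> \<le> A' * (f y - f xs) + 1/2 * (norm (z - xs))\<^sup>2
      + ((- A' * c) * (g \<bullet> g) + (A' * c\<^sup>2 / 2) * ((ell * L) * (g \<bullet> g)))
      + ((- a) * ((z - xs) \<bullet> g) + (a\<^sup>2 / 2) * (\<omega> * (g \<bullet> g)))"
    using A' by (intro add_mono mult_left_mono order_refl loewner_le_scaled_identityD e2 e3) auto
  also have "\<dots> = A' * (f y - f xs) + 1/2 * (norm (z - xs))\<^sup>2
      + (- A' * c + A' * c * (c * (ell * L)) / 2 + \<omega> * a\<^sup>2 / 2) * (g \<bullet> g) - a * (g \<bullet> (z - xs))"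
    by (simp add: algebra_simps inner_commute power2_eq_square)
  also have "c * (ell * L) = 1"
    using L pos by (simp add: c_def)
  \<comment> \<open>With \<open>c = 2 * m\<close> the three terms are \<open>- 2 * m * A'\<close>,
    \<open>m * A'\<close> and, by the equation for \<open>a\<close>, again
    \<open>m * A'\<close>.\<close>
  also have "- A' * c + A' * c * 1 / 2 + \<omega> * a\<^sup>2 / 2 = 0"
    unfolding quad m(2) by (simp add: algebra_simps)
  \<comment> \<open>Since \<open>y\<close> is the average of \<open>x\<close> and \<open>z\<close>
    with weights \<open>A\<close> and \<open>a\<close>, the direction \<open>z - xs\<close> can be
    expressed through displacements from \<open>y\<close>, where the tangent inequality
    holds.\<close>
  also have "a * (g \<bullet> (z - xs)) = - a * (g \<bullet> (xs - y)) - A * (g \<bullet> (x - y))"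
  proof -
    have "A' *\<^sub>R y = A *\<^sub>R x + a *\<^sub>R z"
      unfolding y_def using A' by (simp add: scaleR_add_right)
    then have "a *\<^sub>R (z - xs) = - a *\<^sub>R (xs - y) - A *\<^sub>R (x - y)"
      unfolding A'_def by (simp add: algebra_simps)
    then have "g \<bullet> (a *\<^sub>R (z - xs)) = g \<bullet> (- a *\<^sub>R (xs - y) - A *\<^sub>R (x - y))"
      by (rule arg_cong)
    then show ?thesis
      by (simp add: inner_diff_right)
  qed
  also have "A' * (f y - f xs) + 1/2 * (norm (z - xs))\<^sup>2 + 0 * (g \<bullet> g)
        - (- a * (g \<bullet> (xs - y)) - A * (g \<bullet> (x - y)))
      \<le> A * (f x - f xs) + 1/2 * (norm (z - xs))\<^sup>2"
  proof -
    have tangent: "f y + g \<bullet> (u - y) \<le> f u" for u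
      unfolding g_def by (rule convex_on_above_gradient[OF convex differentiable])
    \<comment> \<open>The tangent inequality is used at \<open>xs\<close> with weight
      \<open>a\<close> and at \<open>x\<close> with weight \<open>A\<close>; the weights sum to
      \<open>A'\<close>, the factor of \<open>f y\<close>.\<close>
    have "a * (f y + g \<bullet> (xs - y)) \<le> a * f xs" "A * (f y + g \<bullet> (x - y)) \<le> A * f x"
      using a pos tangent by (auto intro: mult_left_mono)
    then show ?thesis
      by (simp add: A'_def algebra_simps)
  qed
  finally have EU: "(\<integral>s. U s \<partial>N) \<le> A * (f x - f xs) + 1/2 * (norm (z - xs))\<^sup>2" .
  have "(\<integral>\<^sup>+s. ennreal (A' * (f (y - c *\<^sub>R G (P s)) - f xs)
            + 1/2 * (norm (z - a *\<^sub>R G (P s) - xs))\<^sup>2) \<partial>N) \<le> (\<integral>\<^sup>+s. ennreal (U s) \<partial>N)"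
    by (intro nn_integral_mono ennreal_leI le_U)
  also have "\<dots> = ennreal (\<integral>s. U s \<partial>N)"
    \<comment> \<open>\<open>U\<close> dominates a nonnegative quantity, so its nonnegative integral
      is its Bochner integral.\<close>
    using order_trans[OF nonneg le_U] by (intro nn_integral_eq_integral U_int AE_I2)
  also have "\<dots> \<le> ennreal (A * (f x - f xs) + 1/2 * (norm (z - xs))\<^sup>2)"
    by (intro ennreal_leI EU)
  finally show ?thesis
    by (simp add: c_def)
qed

section \<open>The natural filtration and independence of the next sketch\<close>

lemma space_past [simp]: "space (past M X k) = space M"
  by (simp add: past_def space_measure_of_conv)

lemma sets_past:
  "sets (past M X k) = sigma_sets (space M) (\<Union>i<k. {X i -` B \<inter> space M | B. B \<in> sets borel})"
  unfolding past_def by (rule sets_measure_of) auto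

lemma sets_past_mono: "k \<le> l \<Longrightarrow> sets (past M X k) \<subseteq> sets (past M X l)"
  unfolding sets_past by (intro sigma_sets_mono') fastforce

lemma measurable_past: "i < k \<Longrightarrow> X i \<in> borel_measurable (past M X k)"
  by (intro measurableI) (auto simp: sets_past intro!: sigma_sets.Basic)

lemma subalgebra_past:
  assumes "\<And>i. X i \<in> borel_measurable M"
  shows "subalgebra M (past M X k)"
proof -
  have "sigma_sets (space M) (\<Union>i<k. {X i -` B \<inter> space M | B. B \<in> sets borel}) \<subseteq> sets M"
    using assms by (intro sets.sigma_sets_subset) (auto intro: measurable_sets)
  then show ?thesis
    by (simp add: subalgebra_def sets_past)
qed

text \<open>The index blocks \<open>{..<k}\<close> and \<open>{k}\<close> are disjoint, and
  preimages of Borel sets are stable under intersection, so the sigma-algebras generated by the two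
  blocks are independent.\<close>

lemma (in prob_space) indep_set_past:
  fixes X :: "nat \<Rightarrow> 'a \<Rightarrow> 'v :: topological_space"
  assumes "indep_vars (\<lambda>_. borel) X UNIV"
  shows "indep_set (sets (past M X k)) {X k -` B \<inter> space M | B. B \<in> sets borel}"
proof -
  let ?E = "\<lambda>i. {X i -` B \<inter> space M | B. B \<in> sets borel}"
  let ?I = "case_bool {..<k} {k}"
  have indep: "indep_sets ?E UNIV"
    using assms by (auto simp: indep_vars_def2)
  have "indep_sets (\<lambda>j. sigma_sets (space M) (\<Union>i\<in>?I j. ?E i)) UNIV"
  proof (rule indep_sets_collect_sigma)
    show "indep_sets ?E (\<Union>j\<in>UNIV. ?I j)"
      using indep by (rule indep_sets_mono_index[rotated]) auto
    show "Int_stable (?E i)" for i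
    proof (rule Int_stableI)
      fix a b assume "a \<in> ?E i" "b \<in> ?E i"
      then obtain A B where "a = X i -` A \<inter> space M" "b = X i -` B \<inter> space M" "A \<in> sets borel" "B \<in> sets borel"
        by auto
      then show "a \<inter> b \<in> ?E i"
        by (intro CollectI exI[of _ "A \<inter> B"]) auto
    qed
    show "disjoint_family ?I"
      by (auto simp: disjoint_family_on_def split: bool.split)
  qed
  also have "(\<lambda>j. sigma_sets (space M) (\<Union>i\<in>?I j. ?E i))
      = case_bool (sets (past M X k)) (sigma_sets (space M) (?E k))"
    by (auto simp: fun_eq_iff sets_past split: bool.split)
  finally have "indep_set (sets (past M X k)) (sigma_sets (space M) (?E k))"
    by (simp add: indep_set_def)
  then show ?thesis
    unfolding indep_set_def by (rule indep_sets_mono_sets) (auto split: bool.split)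
qed

text \<open>The library's \<open>indep_var\<close> needs both variables to have the same value type, so the product law of
  the sample point (seen through \<open>past M X k\<close>) and \<open>X k\<close> is built here by hand.\<close>

lemma (in prob_space) nn_integral_past:
  fixes X :: "nat \<Rightarrow> 'a \<Rightarrow> 'v :: topological_space"
  assumes indep: "indep_vars (\<lambda>_. borel) X UNIV"
    and h [measurable]: "h \<in> borel_measurable (past M X k \<Otimes>\<^sub>M borel)"
  shows "(\<integral>\<^sup>+s. h (s, X k s) \<partial>M) = (\<integral>\<^sup>+s. (\<integral>\<^sup>+v. h (s, v) \<partial>distr M borel (X k)) \<partial>M)"
proof -
  have X [measurable]: "random_variable borel (X i)" for i
    using indep by (auto simp: indep_vars_def2)
  have sub: "sets (past M X k) \<subseteq> events"
    using subalgebra_past[of X, OF X] by (simp add: subalgebra_def)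
  \<comment> \<open>The sample point itself, observed in the coarser sigma-algebra, serves as the
    random variable that carries the past.\<close>
  then have id [measurable]: "(\<lambda>s. s) \<in> M \<rightarrow>\<^sub>M past M X k"
    using sets.sets_into_space[of _ "past M X k"]
    by (intro measurableI) (auto simp: Int_absorb2)
  interpret F: prob_space "distr M (past M X k) (\<lambda>s. s)"
    by (rule prob_space_distr) measurable
  interpret Y: prob_space "distr M borel (X k)"
    by (rule prob_space_distr) measurable
  \<comment> \<open>It suffices to compare the measures on rectangles, and there independence gives
    the product.\<close>
  have D: "distr M (past M X k) (\<lambda>s. s) \<Otimes>\<^sub>M distr M borel (X k)
      = distr M (past M X k \<Otimes>\<^sub>M borel) (\<lambda>s. (s, X k s))"
  proof (rule pair_measure_eqI)
    fix A B
    assume "A \<in> sets (distr M (past M X k) (\<lambda>s. s))" "B \<in> sets (distr M borel (X k))"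
    then have A: "A \<in> sets (past M X k)" "A \<in> events" "A \<subseteq> space M" and B: "B \<in> sets borel"
      using sub sets.sets_into_space[of A "past M X k"] by auto
    have "emeasure (distr M (past M X k \<Otimes>\<^sub>M borel) (\<lambda>s. (s, X k s))) (A \<times> B)
        = emeasure M (A \<inter> (X k -` B \<inter> space M))"
      using A B by (subst emeasure_distr) (auto intro!: arg_cong[where f="emeasure M"])
    also have "\<dots> = emeasure M A * emeasure M (X k -` B \<inter> space M)"
    proof -
      have "X k -` B \<inter> space M \<in> {X k -` B \<inter> space M | B. B \<in> sets borel}"
        using B by blast
      from indep_setD[OF indep_set_past[OF indep] A(1) this] show ?thesis
        by (simp add: emeasure_eq_measure ennreal_mult)
    qed
    also have "\<dots> = emeasure (distr M (past M X k) (\<lambda>s. s)) A * emeasure (distr M borel (X k)) B"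
      using A B by (simp add: emeasure_distr Int_absorb2)
    finally show "emeasure (distr M (past M X k) (\<lambda>s. s)) A * emeasure (distr M borel (X k)) B
        = emeasure (distr M (past M X k \<Otimes>\<^sub>M borel) (\<lambda>s. (s, X k s))) (A \<times> B)" ..
  qed (simp_all add: F.sigma_finite_measure Y.sigma_finite_measure F.sigma_finite_measure_axioms
        Y.sigma_finite_measure_axioms cong: sets_pair_measure_cong)
  have "(\<integral>\<^sup>+s. h (s, X k s) \<partial>M)
      = (\<integral>\<^sup>+p. h p \<partial>distr M (past M X k \<Otimes>\<^sub>M borel) (\<lambda>s. (s, X k s)))"
    by (rule nn_integral_distr[symmetric]) measurable
  also have "\<dots> = (\<integral>\<^sup>+s. (\<integral>\<^sup>+v. h (s, v) \<partial>distr M borel (X k)) \<partial>distr M (past M X k) (\<lambda>s. s))"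
    unfolding D[symmetric] by (rule Y.nn_integral_fst[symmetric]) measurable
  also have "\<dots> = (\<integral>\<^sup>+s. (\<integral>\<^sup>+v. h (s, v) \<partial>distr M borel (X k)) \<partial>M)"
    by (rule nn_integral_distr) measurable
  finally show ?thesis .
qed

section \<open>Nonnegative supermartingales and the maximal inequality\<close>

text \<open>The hypothesis is tested on the event \<open>D\<close> where the conditional expectation
  exceeds \<open>X\<close>. The difference is positive on \<open>D\<close> but has integral at most
  zero there, so \<open>D\<close> is null.\<close>

lemma (in prob_space) real_cond_exp_le:
  assumes F: "subalgebra M F"
    and Y: "integrable M Y" and X: "integrable M X" "X \<in> borel_measurable F"
    and le: "\<And>B. B \<in> sets F \<Longrightarrow> (\<integral>s\<in>B. Y s \<partial>M) \<le> (\<integral>s\<in>B. X s \<partial>M)"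
  shows "AE s in M. real_cond_exp M F Y s \<le> X s"
proof -
  interpret finite_measure_subalgebra M F
    by unfold_locales (fact F)
  define E where "E = real_cond_exp M F Y"
  define D where "D = {s \<in> space F. X s < E s}"
  have [measurable]: "E \<in> borel_measurable F" "X \<in> borel_measurable F"
    using X by (auto simp: E_def)
  have D: "D \<in> sets F"
    unfolding D_def by measurable
  then have DM: "D \<in> sets M"
    using F by (auto simp: subalgebra_def)
  have E: "integrable M E"
    unfolding E_def using Y by (rule real_cond_exp_int)
  have iE: "set_integrable M D E" and iX: "set_integrable M D X"
    unfolding set_integrable_def by (intro integrable_mult_indicator DM E X(1))+
  have "(\<integral>s\<in>D. E s \<partial>M) \<le> (\<integral>s\<in>D. X s \<partial>M)"
    using le[OF D] real_cond_exp_intA[OF Y D] by (simp add: E_def)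
  then have le0: "(\<integral>s\<in>D. E s - X s \<partial>M) \<le> 0"
    using iE iX by simp
  have nonneg: "0 \<le> indicator D s *\<^sub>R (E s - X s)" for s
    by (auto simp: indicator_def D_def)
  have "AE s in M. indicator D s *\<^sub>R (E s - X s) = 0"
  proof (subst integral_nonneg_eq_0_iff_AE[symmetric])
    show "integrable M (\<lambda>s. indicator D s *\<^sub>R (E s - X s))"
      using E X DM by (intro integrable_mult_indicator Bochner_Integration.integrable_diff)
    have "0 \<le> (\<integral>s. indicator D s *\<^sub>R (E s - X s) \<partial>M)"
      by (intro Bochner_Integration.integral_nonneg nonneg)
    with le0 show "(\<integral>s. indicator D s *\<^sub>R (E s - X s) \<partial>M) = 0"
      by (simp add: set_lebesgue_integral_def)
  qed (use nonneg in auto)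
  from this AE_space show ?thesis
  proof eventually_elim
    case (elim s)
    then have "s \<notin> D"
      by (auto simp: D_def)
    with elim F show ?case
      by (simp add: D_def E_def subalgebra_def not_less)
  qed
qed

text \<open>The step hypothesis with \<open>B = space M\<close> propagates integrability from
  \<open>X 0\<close> by induction. After that both sides are real integrals and
  \<open>real_cond_exp_le\<close> applies.\<close>

lemma (in prob_space) nonneg_supermartingaleI:
  assumes F: "\<And>k. subalgebra M (F k)" "\<And>k. sets (F k) \<subseteq> sets (F (Suc k))"
    and X: "\<And>k. X k \<in> borel_measurable (F k)"
    and nonneg: "\<And>k s. s \<in> space M \<Longrightarrow> 0 \<le> X k s"
    and X0: "integrable M (X 0)"
    and step: "\<And>k B. B \<in> sets (F k) \<Longrightarrow>
      (\<integral>\<^sup>+s. ennreal (X (Suc k) s) * indicator B s \<partial>M) \<le> (\<integral>\<^sup>+s. ennreal (X k s) * indicator B s \<partial>M)"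
  shows "supermartingale M F X"
proof -
  have meas [measurable]: "X k \<in> borel_measurable M" for k
    using measurable_from_subalg[OF F(1) X] .
  have int: "integrable M (X k)" for k
  proof (induction k)
    case (Suc k)
    have "(\<integral>\<^sup>+s. ennreal (X (Suc k) s) \<partial>M) \<le> (\<integral>\<^sup>+s. ennreal (X k s) \<partial>M)"
    proof -
      have "space M \<in> sets (F k)"
        using F(1)[of k] sets.top[of "F k"] by (simp add: subalgebra_def)
      from step[OF this] show ?thesis
        by (simp cong: nn_integral_cong)
    qed
    also have "\<dots> < \<infinity>"
      using Suc nonneg by (subst nn_integral_eq_integral) (auto intro!: AE_I2)
    finally show ?case
      using nonneg by (intro integrableI_nonneg AE_I2) auto
  qed (fact X0)
  have eq: "(\<integral>\<^sup>+s. ennreal (X k s) * indicator B s \<partial>M) = ennreal (\<integral>s\<in>B. X k s \<partial>M)"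
    if "B \<in> sets M" for k B
  proof -
    have "(\<integral>\<^sup>+s. ennreal (X k s) * indicator B s \<partial>M) = (\<integral>\<^sup>+s. ennreal (indicator B s *\<^sub>R X k s) \<partial>M)"
      by (intro nn_integral_cong) (auto simp: indicator_def)
    also have "\<dots> = ennreal (\<integral>s\<in>B. X k s \<partial>M)"
      unfolding set_lebesgue_integral_def using nonneg that int
      by (intro nn_integral_eq_integral integrable_mult_indicator AE_I2) auto
    finally show ?thesis .
  qed
  have "AE s in M. real_cond_exp M (F k) (X (Suc k)) s \<le> X k s" for k
  proof (rule real_cond_exp_le[OF F(1) int int X])
    fix B assume B: "B \<in> sets (F k)"
    then have BM: "B \<in> sets M"
      using F(1)[of k] by (auto simp: subalgebra_def)
    \<comment> \<open>An inequality between \<open>ennreal\<close> values gives one between reals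
      only if the larger real is nonnegative.\<close>
    have "0 \<le> (\<integral>s\<in>B. X k s \<partial>M)"
      unfolding set_lebesgue_integral_def using nonneg
      by (intro integral_nonneg_AE AE_I2) auto
    then show "(\<integral>s\<in>B. X (Suc k) s \<partial>M) \<le> (\<integral>s\<in>B. X k s \<partial>M)"
      using step[OF B] by (simp add: eq[OF BM])
  qed
  with F X int show ?thesis
    by (auto simp: supermartingale_def)
qed

lemma (in prob_space) supermartingale_set_integral_le:
  assumes X: "supermartingale M F X" and B: "B \<in> sets (F k)"
  shows "(\<integral>s\<in>B. X (Suc k) s \<partial>M) \<le> (\<integral>s\<in>B. X k s \<partial>M)"
proof -
  have F: "subalgebra M (F k)" and int: "integrable M (X k)" "integrable M (X (Suc k))"
    and le: "AE s in M. real_cond_exp M (F k) (X (Suc k)) s \<le> X k s"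
    using X by (auto simp: supermartingale_def)
  interpret finite_measure_subalgebra M "F k"
    by unfold_locales (fact F)
  have BM: "B \<in> sets M"
    using B F by (auto simp: subalgebra_def)
  have "(\<integral>s\<in>B. X (Suc k) s \<partial>M) = (\<integral>s\<in>B. real_cond_exp M (F k) (X (Suc k)) s \<partial>M)"
    by (rule real_cond_exp_intA[OF int(2) B])
  also have "\<dots> \<le> (\<integral>s\<in>B. X k s \<partial>M)"
    unfolding set_lebesgue_integral_def
    using le by (intro integral_mono_AE integrable_mult_indicator BM real_cond_exp_int int)
      (auto elim!: eventually_mono simp: indicator_def)
  finally show ?thesis .
qed

lemma (in prob_space) Ville_inequality:
  assumes X: "supermartingale M F X" and nonneg: "\<And>k s. s \<in> space M \<Longrightarrow> 0 \<le> X k s"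
    and l: "0 \<le> l"
  shows "l * prob {s \<in> space M. \<exists>k. l < X k s} \<le> expectation (X 0)"
proof -
  have F: "subalgebra M (F k)" "sets (F k) \<subseteq> sets (F (Suc k))" and XF: "X k \<in> borel_measurable (F k)"
    and int: "integrable M (X k)" for k
    using X by (auto simp: supermartingale_def)
  have meas [measurable]: "X k \<in> borel_measurable M" for k
    using measurable_from_subalg[OF F(1) XF] .
  have iB: "set_integrable M B (X k)" if "B \<in> sets M" for B k
    unfolding set_integrable_def using that int by (rule integrable_mult_indicator)
  have iC: "set_integrable M B (\<lambda>_. l)" if "B \<in> sets M" for B
    unfolding set_integrable_def using that by (rule integrable_mult_indicator) simp
  \<comment> \<open>By induction on \<open>n\<close>, the process frozen when it first exceeds \<open>l\<close> keeps its mean below \<open>E (X 0)\<close>.\<close>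
  define B where "B = (\<lambda>n. {s \<in> space M. \<forall>j\<le>n. X j s \<le> l})"
  have [measurable]: "B n \<in> sets M" for n
    unfolding B_def by measurable
  \<comment> \<open>\<open>B n\<close> is decided by times up to \<open>n\<close>, so the
    supermartingale inequality may be integrated over it.\<close>
  have BF: "B n \<in> sets (F n)" for n
  proof -
    have "X j \<in> borel_measurable (F n)" if "j \<le> n" for j
    proof -
      have "sets (F j) \<subseteq> sets (F n)"
        using lift_Suc_mono_le[of "\<lambda>n. sets (F n)"] F(2) that by blast
      moreover have "space (F j) = space (F n)"
        using F(1) by (simp add: subalgebra_def)
      ultimately show ?thesis
        using XF[of j] by (auto simp: measurable_def)
    qed
    then have "{s \<in> space (F n). X j s \<le> l} \<in> sets (F n)" if "j \<in> {..n}" for j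
      using that by (simp add: borel_measurable_iff_le)
    then have "{s \<in> space (F n). \<forall>j\<in>{..n}. X j s \<le> l} \<in> sets (F n)"
      by (rule sets.sets_Collect_finite_All) simp_all
    moreover have "{s \<in> space (F n). \<forall>j\<in>{..n}. X j s \<le> l} = B n"
      using F(1)[of n] by (auto simp: B_def subalgebra_def)
    ultimately show ?thesis
      by simp
  qed
  have bound: "l * prob (space M - B n) + (\<integral>s\<in>B n. X n s \<partial>M) \<le> expectation (X 0)" for n
  proof (induction n)
    case 0
    have "l * prob (space M - B 0) = (\<integral>s\<in>space M - B 0. l \<partial>M)"
      by (simp add: set_lebesgue_integral_def)
    also have "\<dots> \<le> (\<integral>s\<in>space M - B 0. X 0 s \<partial>M)"
      by (intro set_integral_mono iB iC) (auto simp: B_def)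
    finally have "l * prob (space M - B 0) + (\<integral>s\<in>B 0. X 0 s \<partial>M)
        \<le> (\<integral>s\<in>space M - B 0. X 0 s \<partial>M) + (\<integral>s\<in>B 0. X 0 s \<partial>M)"
      by simp
    also have "\<dots> = (\<integral>s\<in>(space M - B 0) \<union> B 0. X 0 s \<partial>M)"
      by (intro set_integral_Un[symmetric] iB) auto
    also have "(space M - B 0) \<union> B 0 = space M"
      by (auto simp: B_def)
    also have "(\<integral>s\<in>space M. X 0 s \<partial>M) = expectation (X 0)"
      by (simp add: set_integral_space int)
    finally show ?case .
  next
    case (Suc n)
    \<comment> \<open>\<open>C\<close> is the event that the level is first exceeded at time
      \<open>Suc n\<close>.\<close>
    define C where "C = B n - B (Suc n)"
    have [measurable]: "C \<in> sets M"
      unfolding C_def by measurable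
    have sub: "B (Suc n) \<subseteq> B n"
      by (auto simp: B_def)
    have "l * prob C = (\<integral>s\<in>C. l \<partial>M)"
      by (simp add: set_lebesgue_integral_def)
    also have "\<dots> \<le> (\<integral>s\<in>C. X (Suc n) s \<partial>M)"
      by (intro set_integral_mono iB iC) (auto simp: C_def B_def le_Suc_eq)
    finally have "l * prob C + (\<integral>s\<in>B (Suc n). X (Suc n) s \<partial>M)
        \<le> (\<integral>s\<in>C. X (Suc n) s \<partial>M) + (\<integral>s\<in>B (Suc n). X (Suc n) s \<partial>M)"
      by simp
    also have "\<dots> = (\<integral>s\<in>C \<union> B (Suc n). X (Suc n) s \<partial>M)"
      by (intro set_integral_Un[symmetric] iB) (auto simp: C_def)
    also have "C \<union> B (Suc n) = B n"
      using sub by (auto simp: C_def)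
    also have "(\<integral>s\<in>B n. X (Suc n) s \<partial>M) \<le> (\<integral>s\<in>B n. X n s \<partial>M)"
      by (rule supermartingale_set_integral_le[OF X BF])
    finally have "l * prob C + (\<integral>s\<in>B (Suc n). X (Suc n) s \<partial>M) \<le> (\<integral>s\<in>B n. X n s \<partial>M)" .
    moreover have "prob (space M - B (Suc n)) = prob (space M - B n) + prob C"
    proof -
      have "space M - B (Suc n) = (space M - B n) \<union> C"
        using sub by (auto simp: C_def B_def)
      also have "prob \<dots> = prob (space M - B n) + prob C"
        by (rule finite_measure_Union) (auto simp: C_def)
      finally show ?thesis .
    qed
    ultimately show ?case
      using Suc by (simp add: algebra_simps)
  qed
  \<comment> \<open>The finite-horizon crossing events increase to the event of ever crossing, which
    passes the bound to an infinite horizon.\<close>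
  have "(\<lambda>n. prob (space M - B n)) \<longlonglongrightarrow> prob (\<Union>n. space M - B n)"
    by (rule finite_Lim_measure_incseq) (auto simp: incseq_def B_def)
  moreover have "(\<Union>n. space M - B n) = {s \<in> space M. \<exists>k. l < X k s}"
    by (auto simp: B_def not_le) (meson leD order_refl)
  ultimately have "(\<lambda>n. l * prob (space M - B n)) \<longlonglongrightarrow> l * prob {s \<in> space M. \<exists>k. l < X k s}"
    by (auto intro: tendsto_mult_left)
  moreover have "l * prob (space M - B n) \<le> expectation (X 0)" for n
  proof -
    have "0 \<le> (\<integral>s\<in>B n. X n s \<partial>M)"
      unfolding set_lebesgue_integral_def using nonneg by (intro integral_nonneg_AE AE_I2) auto
    with bound[of n] show ?thesis
      by simp
  qed
  ultimately show ?thesis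
    by (intro LIMSEQ_le_const2) auto
qed

text \<open>For a positive mean, the maximal inequality at levels tending to infinity makes the
  supremum almost surely finite. Writing the bound as a multiple of the mean also says that a
  process of mean zero at the start vanishes almost surely; that case uses levels tending to
  zero.\<close>

lemma (in prob_space) AE_supermartingale_bounded:
  assumes X: "supermartingale M F X" and nonneg: "\<And>k s. s \<in> space M \<Longrightarrow> 0 \<le> X k s"
  shows "AE s in M. \<exists>c. \<forall>k. X k s \<le> expectation (X 0) * c"
proof -
  let ?e = "expectation (X 0)"
  have meas [measurable]: "X k \<in> borel_measurable M" for k
    using X by (auto simp: supermartingale_def)
  have e: "0 \<le> ?e"
    using nonneg by (intro integral_nonneg_AE AE_I2) auto
  show ?thesis
  proof (cases "?e = 0")
    case True
    have "AE s in M. \<forall>k. X k s \<le> inverse (real (Suc n))" for n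
    proof -
      have "inverse (real (Suc n)) * prob {s \<in> space M. \<exists>k. inverse (real (Suc n)) < X k s} \<le> 0"
        using Ville_inequality[OF X nonneg, of "inverse (real (Suc n))"] True by simp
      then have "prob {s \<in> space M. \<exists>k. inverse (real (Suc n)) < X k s} = 0"
        by (simp add: mult_le_0_iff measure_le_0_iff)
      then show ?thesis
        by (subst (asm) prob_eq_0) (auto simp: not_less)
    qed
    then have "AE s in M. \<forall>n k. X k s \<le> inverse (real (Suc n))"
      by (simp add: AE_all_countable)
    then show ?thesis
    proof eventually_elim
      case (elim s)
      have "X k s \<le> 0" for k
        using elim by (intro LIMSEQ_le_const[OF LIMSEQ_inverse_real_of_nat]) auto
      with True show ?case
        by auto
    qed
  next
    case False
    \<comment> \<open>\<open>U\<close> is the event of an infinite supremum. It lies in every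
      crossing event of level \<open>?e * real (Suc n)\<close>, whose probability is at most
      \<open>1 / (n + 1)\<close>.\<close>
    define U where "U = {s \<in> space M. \<forall>n. \<exists>k. ?e * real (Suc n) < X k s}"
    have [measurable]: "U \<in> sets M"
      unfolding U_def by measurable
    have "prob U \<le> inverse (real (Suc n))" for n
    proof -
      have "?e * (real (Suc n) * prob U)
          \<le> ?e * real (Suc n) * prob {s \<in> space M. \<exists>k. ?e * real (Suc n) < X k s}"
        using e unfolding mult.assoc
        by (intro mult_left_mono finite_measure_mono) (auto simp: U_def)
      also have "\<dots> \<le> ?e * 1"
        using Ville_inequality[OF X nonneg, of "?e * real (Suc n)"] e by simp
      finally have "real (Suc n) * prob U \<le> 1"
        using e False by (subst (asm) mult_le_cancel_left_pos) auto
      then show ?thesis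
        by (simp add: field_simps)
    qed
    then have "prob U \<le> 0"
      by (intro LIMSEQ_le_const[OF LIMSEQ_inverse_real_of_nat]) auto
    then have "AE s in M. s \<notin> U"
      using measure_nonneg[of M U] by (subst prob_eq_0[symmetric]) auto
    from this AE_space show ?thesis
    proof eventually_elim
      case (elim s)
      then show ?case
        by (auto simp: U_def not_less)
    qed
  qed
qed

section \<open>Measurability of the iterates and divergence of the logarithmic factor\<close>

text \<open>The state of index \<open>k\<close> uses only the sketches of index below
  \<open>k\<close>. With \<open>past M S k\<close> for \<open>F\<close> this makes the iterates
  adapted.\<close>

lemma borel_measurable_rs_nag_c:
  fixes f :: "real ^ 'd \<Rightarrow> real" and S :: "nat \<Rightarrow> 'a \<Rightarrow> real ^ 'r ^ 'd"
  assumes differentiable: "\<And>u. f differentiable (at u)"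
    and S: "\<And>i. i < k \<Longrightarrow> S i \<in> borel_measurable F"
  shows "(\<lambda>s. fst (rs_nag_c f L \<omega> ell x0 (\<lambda>i. S i s) k)) \<in> borel_measurable F \<and>
    (\<lambda>s. snd (rs_nag_c f L \<omega> ell x0 (\<lambda>i. S i s) k)) \<in> borel_measurable F"
  using S
proof (induction k)
  case (Suc k)
  note [measurable] = borel_measurable_gradient[OF differentiable]
  have [measurable]: "S k \<in> borel_measurable F"
    "(\<lambda>s. fst (rs_nag_c f L \<omega> ell x0 (\<lambda>i. S i s) k)) \<in> borel_measurable F"
    "(\<lambda>s. snd (rs_nag_c f L \<omega> ell x0 (\<lambda>i. S i s) k)) \<in> borel_measurable F"
    using Suc by auto
  show ?case
    unfolding rs_nag_c.simps Let_def split_beta fst_conv snd_conv by measurable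
qed simp

text \<open>The ceiling dominates the logarithm and so diverges; composing with the divergent real
  function \<open>t * ln t powr (1 + \<epsilon>)\<close> gives the claim.\<close>

lemma eventually_log_bound_ge:
  assumes "0 < \<epsilon>"
  shows "\<forall>\<^sub>F k :: nat in sequentially.
    c \<le> real_of_int \<lceil>log 2 (real k)\<rceil> * ln (real_of_int \<lceil>log 2 (real k)\<rceil>) powr (1 + \<epsilon>)"
proof -
  have "filterlim (\<lambda>k. log 2 (real k)) at_top sequentially"
    by real_asymp
  then have ceil: "filterlim (\<lambda>k. real_of_int \<lceil>log 2 (real k)\<rceil>) at_top sequentially"
    by (rule filterlim_at_top_mono) auto
  have "filterlim (\<lambda>t :: real. t * ln t powr (1 + \<epsilon>)) at_top at_top"
    using assms by real_asymp
  from filterlim_compose[OF this ceil] show ?thesis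
    by (simp add: filterlim_at_top)
qed

section \<open>The supermartingale, the tail bound and the almost sure rate\<close>

theorem propositionI1:
  fixes f :: "real ^ 'd \<Rightarrow> real" and xs x0 :: "real ^ 'd"
    and LL :: "real ^ 'd ^ 'd" and L \<omega> ell m :: real
    and N :: "'b measure" and P :: "'b \<Rightarrow> real ^ 'r ^ 'd"
    and M :: "'a measure" and S :: "nat \<Rightarrow> 'a \<Rightarrow> real ^ 'r ^ 'd"
    and A :: "nat \<Rightarrow> real" and x z :: "nat \<Rightarrow> 'a \<Rightarrow> real ^ 'd" and \<Phi> :: "nat \<Rightarrow> 'a \<Rightarrow> real"
  assumes dims: "2 \<le> CARD('d)" "CARD('r) \<le> CARD('d)"
    and differentiable: "\<And>u. f differentiable (at u)"
    and convex: "convex_on UNIV f"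
    and minimizer: "\<And>u. f xs \<le> f u"
    and LL: "psd LL" "LL \<noteq> 0"
    and smooth: "matrix_smooth f LL"
    and L: "L = onorm ((*v) LL)"
    and pos: "0 < \<omega>" "0 < ell"
    and prob_N: "prob_space N"
    and moments: "sketch_moments N P LL \<omega> ell"
    and prob_M: "prob_space M"
    and indep: "prob_space.indep_vars M (\<lambda>_. borel) S UNIV"
    and copies: "\<And>k. distr M borel (S k) = distr N borel P"
    and m: "m = 1 / (2 * L * ell)"
    and A: "A = nag_A m \<omega>"
    and x: "x = (\<lambda>k s. fst (rs_nag_c f L \<omega> ell x0 (\<lambda>i. S i s) k))"
    and z: "z = (\<lambda>k s. snd (rs_nag_c f L \<omega> ell x0 (\<lambda>i. S i s) k))"
    and Phi: "\<Phi> = (\<lambda>k s. A k * (f (x k s) - f xs) + 1/2 * (norm (z k s - xs))\<^sup>2)"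
  shows "supermartingale M (past M S) \<Phi> \<and>
    (\<forall>k. \<forall>s\<in>space M. 0 \<le> \<Phi> k s) \<and>
    (\<forall>k\<ge>1. 0 < A k) \<and>
    (\<forall>\<eta>\<in>{0<..<1}.
       measure M {s \<in> space M.
         (\<forall>k. A k * (f (x k s) - f xs) \<le> \<Phi> 0 s / \<eta>) \<and>
         (\<forall>k\<ge>1. f (x k s) - f xs \<le> \<Phi> 0 s / (\<eta> * A k))} \<ge> 1 - \<eta>) \<and>
    (\<forall>k. A k \<ge> m / (2 * \<omega>) * (real k)\<^sup>2 \<and>
         m / (2 * \<omega>) * (real k)\<^sup>2 = (real k)\<^sup>2 / (4 * L * ell * \<omega>)) \<and>
    (\<forall>\<epsilon>>0. \<exists>K \<in> measurable M (count_space (UNIV :: nat set)).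
       AE s in M. \<forall>k\<ge>K s.
         (let c = real_of_int \<lceil>log 2 (real k)\<rceil>;
              b = c * (ln c) powr (1 + \<epsilon>)
          in A k * (f (x k s) - f xs) \<le> \<Phi> 0 s * b \<and>
             f (x k s) - f xs \<le> \<Phi> 0 s * b / A k \<and>
             f (x k s) - f xs \<le> 4 * L * ell * \<omega> * \<Phi> 0 s * (b / (real k)\<^sup>2)))"
proof -
  interpret prob_space M by fact
  have "0 < L"
  proof -
    have "onorm ((*v) LL) \<noteq> 0"
      using LL(2) onorm_eq_0[OF matrix_vector_mul_bounded_linear[of LL]]
      by (metis matrix_eq matrix_vector_mult_0)
    then show ?thesis
      unfolding L using onorm_pos_le[OF matrix_vector_mul_bounded_linear[of LL]] by simp
  qed
  then have m_pos: "0 < m"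
    using pos by (simp add: m)
  have A_nonneg: "0 \<le> A k" for k
    unfolding A using nag_A_nonneg m_pos pos by blast
  have growth: "m / (2 * \<omega>) * (real k)\<^sup>2 \<le> A k" for k
    unfolding A using nag_A_growth m_pos pos by blast
  have growth_eq: "m / (2 * \<omega>) * (real k)\<^sup>2 = (real k)\<^sup>2 / (4 * L * ell * \<omega>)" for k
    by (simp add: m field_simps)
  have A_pos: "0 < A k" if "k \<ge> 1" for k
    using growth[of k] m_pos pos that
    by (smt (verit) divide_pos_pos mult_pos_pos of_nat_0_less_iff zero_less_power less_eq_Suc_le One_nat_def)
  have S_meas [measurable]: "random_variable borel (S k)" for k
    using indep by (auto simp: indep_vars_def2)
  have "continuous_on UNIV f"
    using differentiable by (meson continuous_at_imp_continuous_on differentiable_imp_continuous_within)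
  then have [measurable]: "f \<in> borel_measurable borel"
    by (rule borel_measurable_continuous_onI)
  note [measurable] = borel_measurable_gradient[OF differentiable]
  have "x k \<in> borel_measurable (past M S k) \<and> z k \<in> borel_measurable (past M S k)" for k
    unfolding x z by (rule borel_measurable_rs_nag_c[OF differentiable]) (rule measurable_past)
  then have xz_past: "x k \<in> borel_measurable (past M S k)" "z k \<in> borel_measurable (past M S k)" for k
    by auto
  have [measurable]: "x k \<in> borel_measurable M" "z k \<in> borel_measurable M" for k
    using measurable_from_subalg[OF subalgebra_past[of S, OF S_meas] xz_past(1)]
      measurable_from_subalg[OF subalgebra_past[of S, OF S_meas] xz_past(2)] by auto
  have Phi_past: "\<Phi> k \<in> borel_measurable (past M S k)" for k
  proof -
    note [measurable] = xz_past
    show ?thesis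
      unfolding Phi by measurable
  qed
  have gap_nonneg: "0 \<le> f u - f xs" for u
    using minimizer by simp
  have Phi_nonneg: "0 \<le> \<Phi> k s" for k s
    unfolding Phi using A_nonneg gap_nonneg by (intro add_nonneg_nonneg mult_nonneg_nonneg) auto
  have gap_le_Phi: "A k * (f (x k s) - f xs) \<le> \<Phi> k s" for k s
    by (simp add: Phi)
  \<comment> \<open>Since \<open>A 0 = 0\<close> and \<open>z 0\<close> is the deterministic
    \<open>x0\<close>, the initial potential is a constant.\<close>
  define \<Phi>0 where "\<Phi>0 = 1/2 * (norm (x0 - xs))\<^sup>2"
  have Phi0: "\<Phi> 0 = (\<lambda>s. \<Phi>0)"
    by (simp add: Phi A z \<Phi>0_def)
  have Phi0_nonneg: "0 \<le> \<Phi>0"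
    by (simp add: \<Phi>0_def)
  have expectation_Phi0: "expectation (\<Phi> 0) = \<Phi>0"
    by (simp add: Phi0 prob_space)
  have super: "supermartingale M (past M S) \<Phi>"
  proof (rule nonneg_supermartingaleI)
    show "subalgebra M (past M S k)" for k
      using S_meas by (rule subalgebra_past)
    show "sets (past M S k) \<subseteq> sets (past M S (Suc k))" for k
      by (rule sets_past_mono) simp
    show "integrable M (\<Phi> 0)"
      by (simp add: Phi0)
    fix k B
    assume B [measurable]: "B \<in> sets (past M S k)"
    define a where "a = nag_incr m \<omega> (A k)"
    define y where "y = (\<lambda>s. (A k / (A k + a)) *\<^sub>R x k s + (a / (A k + a)) *\<^sub>R z k s)"
    \<comment> \<open>\<open>H s Q\<close> is the next potential with the past read from
      \<open>s\<close> and the fresh sketch left as a free argument \<open>Q\<close>. This is the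
      form to which the product law applies.\<close>
    define H where "H = (\<lambda>s (Q :: real ^ 'r ^ 'd). (A k + a) * (f (y s - (1 / (L * ell)) *\<^sub>R (sketch Q *v gradient f (y s))) - f xs)
        + 1/2 * (norm (z k s - a *\<^sub>R (sketch Q *v gradient f (y s)) - xs))\<^sup>2)"
    have Phi_Suc: "\<Phi> (Suc k) s = H s (S k s)" for s
      by (simp add: Phi H_def y_def a_def x z A m Let_def split_beta)
    have H_meas: "(\<lambda>(s, Q). ennreal (H s Q) * indicator B s) \<in> borel_measurable (past M S k \<Otimes>\<^sub>M borel)"
    proof -
      note [measurable] = xz_past
      show ?thesis
        unfolding H_def y_def by measurable
    qed
    have "(\<integral>\<^sup>+s. ennreal (\<Phi> (Suc k) s) * indicator B s \<partial>M)
        = (\<integral>\<^sup>+s. (\<integral>\<^sup>+Q. ennreal (H s Q) * indicator B s \<partial>distr M borel (S k)) \<partial>M)"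
      using nn_integral_past[OF indep H_meas] by (simp add: Phi_Suc)
    also have "\<dots> \<le> (\<integral>\<^sup>+s. ennreal (\<Phi> k s) * indicator B s \<partial>M)"
    proof (rule nn_integral_mono)
      fix s assume "s \<in> space M"
      have P [measurable]: "P \<in> borel_measurable N"
        using moments by (simp add: sketch_moments_def)
      have [measurable]: "H s \<in> borel_measurable borel"
        unfolding H_def by measurable
      \<comment> \<open>Only the law of \<open>S k\<close> matters once the past is fixed, so
        \<open>P\<close> on \<open>N\<close> can replace it.\<close>
      have "(\<integral>\<^sup>+Q. ennreal (H s Q) * indicator B s \<partial>distr M borel (S k))
          = (\<integral>\<^sup>+t. ennreal (H s (P t)) \<partial>N) * indicator B s"
        unfolding copies by (simp add: nn_integral_distr nn_integral_multc)
      also have "\<dots> \<le> ennreal (\<Phi> k s) * indicator B s"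
        using sketch_step_bound[OF differentiable convex minimizer smooth L \<open>0 < L\<close> pos A_nonneg[of k]
            prob_N moments, where x = "x k s" and z = "z k s"]
        unfolding H_def y_def a_def Phi m by (intro mult_right_mono) auto
      finally show "(\<integral>\<^sup>+Q. ennreal (H s Q) * indicator B s \<partial>distr M borel (S k))
          \<le> ennreal (\<Phi> k s) * indicator B s" .
    qed
    finally show "(\<integral>\<^sup>+s. ennreal (\<Phi> (Suc k) s) * indicator B s \<partial>M)
        \<le> (\<integral>\<^sup>+s. ennreal (\<Phi> k s) * indicator B s \<partial>M)" .
  qed (rule Phi_past Phi_nonneg)+
  have bounded: "AE s in M. \<exists>c. \<forall>k. \<Phi> k s \<le> \<Phi>0 * c"
    using AE_supermartingale_bounded[OF super Phi_nonneg] by (simp add: expectation_Phi0)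
  have tail: "1 - \<eta> \<le> measure M {s \<in> space M.
         (\<forall>k. A k * (f (x k s) - f xs) \<le> \<Phi> 0 s / \<eta>) \<and>
         (\<forall>k\<ge>1. f (x k s) - f xs \<le> \<Phi> 0 s / (\<eta> * A k))}" if \<eta>: "0 < \<eta>" "\<eta> < 1" for \<eta>
  proof -
    define E where "E = {s \<in> space M. \<forall>k. A k * (f (x k s) - f xs) \<le> \<Phi>0 / \<eta>}"
    have [measurable]: "E \<in> events"
      unfolding E_def by measurable
    \<comment> \<open>Dividing by \<open>A k > 0\<close> derives the second family of bounds from
      the first, so both hold on the same event.\<close>
    have E_eq: "{s \<in> space M.
         (\<forall>k. A k * (f (x k s) - f xs) \<le> \<Phi> 0 s / \<eta>) \<and>
         (\<forall>k\<ge>1. f (x k s) - f xs \<le> \<Phi> 0 s / (\<eta> * A k))} = E"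
    proof -
      have "f (x k s) - f xs \<le> \<Phi>0 / (\<eta> * A k)"
        if "A k * (f (x k s) - f xs) \<le> \<Phi>0 / \<eta>" "k \<ge> 1" for k s
        using that(1) A_pos[OF that(2)] \<eta> by (simp add: field_simps)
      then show ?thesis
        by (auto simp: E_def Phi0)
    qed
    have "1 - \<eta> \<le> prob E"
    \<comment> \<open>At \<open>\<Phi>0 = 0\<close> the maximal inequality would be used at level
      \<open>0\<close> and say nothing. The almost sure bound then gives probability one.\<close>
    proof (cases "\<Phi>0 = 0")
      case True
      have "AE s in M. s \<in> E"
        using bounded AE_space
      proof eventually_elim
        case (elim s)
        then have "A k * (f (x k s) - f xs) \<le> \<Phi>0 / \<eta>" for k
          using True gap_le_Phi[of k s] by (auto intro: order_trans)
        with elim show ?case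
          by (simp add: E_def)
      qed
      then have "prob E = 1"
        by (simp add: prob_eq_1)
      with \<eta> show ?thesis
        by simp
    next
      case False
      then have e: "0 < \<Phi>0"
        using Phi0_nonneg by simp
      have [measurable]: "\<Phi> k \<in> borel_measurable M" for k
        using super by (auto simp: supermartingale_def)
      have "\<Phi>0 / \<eta> * prob {s \<in> space M. \<exists>k. \<Phi>0 / \<eta> < \<Phi> k s} \<le> \<Phi>0"
        using Ville_inequality[OF super Phi_nonneg, of "\<Phi>0 / \<eta>"] Phi0_nonneg \<eta>
        by (simp add: expectation_Phi0)
      then have "prob {s \<in> space M. \<exists>k. \<Phi>0 / \<eta> < \<Phi> k s} \<le> \<eta>"
        using e \<eta> by (simp add: field_simps)
      moreover have "prob (space M - E) \<le> prob {s \<in> space M. \<exists>k. \<Phi>0 / \<eta> < \<Phi> k s}"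
      proof (rule finite_measure_mono)
        show "space M - E \<subseteq> {s \<in> space M. \<exists>k. \<Phi>0 / \<eta> < \<Phi> k s}"
          by (auto simp: E_def not_le) (meson gap_le_Phi less_le_trans)
      qed measurable
      ultimately show ?thesis
        by (simp add: prob_compl)
    qed
    then show ?thesis
      unfolding E_eq .
  qed
  have rate: "\<exists>K \<in> measurable M (count_space (UNIV :: nat set)).
       AE s in M. \<forall>k\<ge>K s.
         (let c = real_of_int \<lceil>log 2 (real k)\<rceil>;
              b = c * (ln c) powr (1 + \<epsilon>)
          in A k * (f (x k s) - f xs) \<le> \<Phi> 0 s * b \<and>
             f (x k s) - f xs \<le> \<Phi> 0 s * b / A k \<and>
             f (x k s) - f xs \<le> 4 * L * ell * \<omega> * \<Phi> 0 s * (b / (real k)\<^sup>2))" if \<epsilon>: "0 < \<epsilon>" for \<epsilon>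
  proof -
    define b where "b = (\<lambda>k :: nat. real_of_int \<lceil>log 2 (real k)\<rceil> * ln (real_of_int \<lceil>log 2 (real k)\<rceil>) powr (1 + \<epsilon>))"
    define good where "good = (\<lambda>k s. A k * (f (x k s) - f xs) \<le> \<Phi>0 * b k \<and>
             f (x k s) - f xs \<le> \<Phi>0 * b k / A k \<and>
             f (x k s) - f xs \<le> 4 * L * ell * \<omega> * \<Phi>0 * (b k / (real k)\<^sup>2))"
    \<comment> \<open>For \<open>k \<ge> 1\<close> both \<open>A k\<close> and
      \<open>(real k)\<^sup>2\<close> are positive, so the quotients are genuine and all three
      bounds follow from the first.\<close>
    have good: "good k s" if k: "k \<ge> 1" and le: "A k * (f (x k s) - f xs) \<le> \<Phi>0 * b k" for k s
    proof -
      have d: "0 < 4 * L * ell * \<omega>" "0 < (real k)\<^sup>2"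
        using \<open>0 < L\<close> pos k by auto
      have "(real k)\<^sup>2 / (4 * L * ell * \<omega>) * (f (x k s) - f xs) \<le> A k * (f (x k s) - f xs)"
        using growth[of k] gap_nonneg unfolding growth_eq by (rule mult_right_mono)
      with le have "(real k)\<^sup>2 / (4 * L * ell * \<omega>) * (f (x k s) - f xs) \<le> \<Phi>0 * b k"
        by simp
      then have "f (x k s) - f xs \<le> 4 * L * ell * \<omega> * \<Phi>0 * (b k / (real k)\<^sup>2)"
        using d by (simp add: divide_simps mult.commute mult.left_commute mult.assoc)
      moreover have "f (x k s) - f xs \<le> \<Phi>0 * b k / A k"
        using le A_pos[OF k] by (simp add: field_simps)
      ultimately show ?thesis
        using le by (simp add: good_def)
    qed
    \<comment> \<open>The least threshold is a measurable choice. It has the required property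
      wherever some threshold exists, hence almost surely.\<close>
    define K where "K = (\<lambda>s. LEAST n. \<forall>k\<ge>n. good k s)"
    have "K \<in> measurable M (count_space UNIV)"
      unfolding K_def good_def by measurable
    moreover have "AE s in M. \<forall>k\<ge>K s. good k s"
      using bounded
    proof eventually_elim
      case (elim s)
      then obtain c where c: "\<And>k. \<Phi> k s \<le> \<Phi>0 * c"
        by auto
      \<comment> \<open>The multiple \<open>c\<close> depends on the sample point but not on
        \<open>k\<close>, so the diverging factor \<open>b k\<close> eventually exceeds it.\<close>
      have "\<forall>\<^sub>F k in sequentially. c \<le> b k \<and> k \<ge> 1"
        unfolding b_def by (intro eventually_conj eventually_log_bound_ge \<epsilon> eventually_ge_at_top)
      then have "\<forall>\<^sub>F k in sequentially. good k s"
      proof eventually_elim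
        case (elim k)
        have "A k * (f (x k s) - f xs) \<le> \<Phi>0 * c"
          using gap_le_Phi c by (rule order_trans)
        also have "\<dots> \<le> \<Phi>0 * b k"
          using elim Phi0_nonneg by (intro mult_left_mono) auto
        finally show ?case
          using elim good by blast
      qed
      then have "\<exists>n. \<forall>k\<ge>n. good k s"
        by (simp add: eventually_sequentially)
      then show ?case
        unfolding K_def by (rule LeastI_ex)
    qed
    ultimately show ?thesis
      unfolding good_def b_def Let_def Phi0 by blast
  qed
  show ?thesis
  proof (intro conjI allI ballI impI)
    show "1 - \<eta> \<le> measure M {s \<in> space M.
         (\<forall>k. A k * (f (x k s) - f xs) \<le> \<Phi> 0 s / \<eta>) \<and>
         (\<forall>k\<ge>1. f (x k s) - f xs \<le> \<Phi> 0 s / (\<eta> * A k))}" if "\<eta> \<in> {0<..<1}" for \<eta>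
      using that by (intro tail) auto
  qed (fact super | rule Phi_nonneg | erule A_pos | rule growth | rule growth_eq | erule rate)+
qed

end
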